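(* Let $t$ be a decision tree over $d$ features with $p$ leaves having scores $s_1,\dots,s_p\in\mathbb{R}$, and for each feature $i\in[d]$ let $\theta_{i1}<\dots<\theta_{iK_i}$ be the distinct split thresholds on feature $i$; put $K=\sum_{i=1}^d K_i$. Let $Q^{misic}$ be the set of $(\bm{x},y,\bm{z})\in\mathbb{R}^{K}\times\mathbb{R}\times\mathbb{R}^{p}$, $\bm{x}=(x_{ij})_{i\in[d],j\in[K_i]}$, satisfying $$\sum_{l\in \mathrm{left}(s)} z_l\le x_{V(s)C(s)},\qquad \sum_{l\in \mathrm{right}(s)} z_l\le 1-x_{V(s)C(s)}\qquad\forall s\in \mathrm{splits}(t),$$ $$x_{ij}\le x_{i,j+1}\ \ \forall i\in[d],\,j\in[K_i-1],\qquad \sum_{l=1}^p z_l=1,\qquad y=\sum_{l=1}^p s_lz_l,\qquad \bm{x}\in[0,1]^K,\quad \bm{z}\ge0,$$ and let $Q^{expset}$ be the set of $(\bm{x},y,\bm{z})$ satisfying the same constraints except that the first two families are replaced by $$\sum_{l\in \mathrm{below}(s)} z_l\le x_{V(s)C(s)},\qquad \sum_{l\in \mathrm{above}(s)} z_l\le 1-x_{V(s)C(s)}\qquad\forall s\in \mathrm{splits}(t).$$ Then $$Q^{expset}\cap\big(\{0,1\}^K\times\mathbb{R}^{1+p}\big)=Q^{misic}\cap\big(\{0,1\}^K\times\mathbb{R}^{1+p}\big)\qquad\text{and}\qquad Q^{expset}\subseteq Q^{misic}.$$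
   Context: Notation: $[n]=\{1,\dots,n\}$. A decision tree is a binary tree. Each internal node is a split $s$, given by a condition $w_i\le\theta$ on one feature $i$; the left branch corresponds to $w_i\le\theta$ and the right branch to $w_i\ge\theta$. $\mathrm{splits}(t)$ is the set of splits of tree $t$. $\mathrm{left}(s)$ and $\mathrm{right}(s)$ are the sets of leaves lying in the left, respectively right, subtree of $s$. For a split $s$ with condition $w_i\le\theta_{ij}$, $V(s)=i$ is its feature and $C(s)=j$ is the rank of its threshold. $\mathrm{below}(s)$ is the union of $\mathrm{left}(s')$ over all splits $s'$ of the tree with $V(s')=V(s)$ and $C(s')\le C(s)$; $\mathrm{above}(s)$ is the union of $\mathrm{right}(s')$ over all splits $s'$ of the tree with $V(s')=V(s)$ and $C(s')\ge C(s)$. Interpretation: $x_{ij}=1$ means $w_i\le\theta_{ij}$, $x_{ij}=0$ means $w_i\ge\theta_{ij}$; $z_l$ indicates that the feature vector lies in leaf $l$. The mixed-integer formulations require only $\bm{x}$ to be binary. *)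

theory Defs
  imports Complex_Main "HOL-Library.FuncSet"
begin

text \<open>
  \<open>Node i \<tau> l r\<close> is a split with condition \<open>w\<^sub>i \<le> \<tau>\<close>; \<open>l\<close> is the branch for \<open>w\<^sub>i \<le> \<tau>\<close>
  and \<open>r\<close> the branch for \<open>w\<^sub>i \<ge> \<tau>\<close>. \<open>Leaf k\<close> is the leaf with index \<open>k\<close>.
\<close>

datatype dtree =
    Leaf nat
  | Node (feature: nat) (threshold: real) (left_branch: dtree) (right_branch: dtree)

primrec leaves :: "dtree \<Rightarrow> nat list" where
  "leaves (Leaf k) = [k]"
| "leaves (Node i \<tau> l r) = leaves l @ leaves r"

text \<open>
  A split is represented by the subtree rooted at it. In a tree whose leaves carry distinct
  indices (see \<open>decision_tree\<close>) distinct internal nodes root distinct subtrees, so this set does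
  not identify different splits, even if they share both feature and threshold.
\<close>

primrec splits :: "dtree \<Rightarrow> dtree set" where
  "splits (Leaf k) = {}"
| "splits (Node i \<tau> l r) = insert (Node i \<tau> l r) (splits l \<union> splits r)"

definition decision_tree :: "nat \<Rightarrow> nat \<Rightarrow> dtree \<Rightarrow> bool" where
  "decision_tree d p t \<longleftrightarrow>
     (\<forall>s\<in>splits t. feature s \<in> {1..d}) \<and> distinct (leaves t) \<and> set (leaves t) = {1..p}"

definition left :: "dtree \<Rightarrow> nat set" where
  "left s = set (leaves (left_branch s))"

definition right :: "dtree \<Rightarrow> nat set" where
  "right s = set (leaves (right_branch s))"

definition thresholds :: "dtree \<Rightarrow> nat \<Rightarrow> real set" where
  "thresholds t i = {threshold s | s. s \<in> splits t \<and> feature s = i}"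

definition num_thresholds :: "dtree \<Rightarrow> nat \<Rightarrow> nat" where
  "num_thresholds t i = card (thresholds t i)"

text \<open>\<open>theta t i j\<close> is the \<open>j\<close>-th smallest threshold on feature \<open>i\<close>, for \<open>1 \<le> j \<le> num_thresholds t i\<close>.\<close>

definition theta :: "dtree \<Rightarrow> nat \<Rightarrow> nat \<Rightarrow> real" where
  "theta t i j = sorted_list_of_set (thresholds t i) ! (j - 1)"

definition V :: "dtree \<Rightarrow> nat" where
  "V s = feature s"

definition C :: "dtree \<Rightarrow> dtree \<Rightarrow> nat" where
  "C t s = (THE j. j \<in> {1..num_thresholds t (V s)} \<and> theta t (V s) j = threshold s)"

definition below :: "dtree \<Rightarrow> dtree \<Rightarrow> nat set" where
  "below t s = (\<Union>s'\<in>{s' \<in> splits t. V s' = V s \<and> C t s' \<le> C t s}. left s')"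

definition above :: "dtree \<Rightarrow> dtree \<Rightarrow> nat set" where
  "above t s = (\<Union>s'\<in>{s' \<in> splits t. V s' = V s \<and> C t s' \<ge> C t s}. right s')"

text \<open>
  \<open>\<real>\<^sup>K\<close> and \<open>\<real>\<^sup>p\<close> are the extensional function spaces \<open>x_index d t \<rightarrow>\<^sub>E UNIV\<close> and
  \<open>{1..p} \<rightarrow>\<^sub>E UNIV\<close>: functions fixed to \<open>undefined\<close> outside the index set, so that equality is
  equality of coordinates.
\<close>

definition x_index :: "nat \<Rightarrow> dtree \<Rightarrow> (nat \<times> nat) set" where
  "x_index d t = (SIGMA i:{1..d}. {1..num_thresholds t i})"

type_synonym point = "(nat \<times> nat \<Rightarrow> real) \<times> real \<times> (nat \<Rightarrow> real)"

definition Q_common :: "nat \<Rightarrow> nat \<Rightarrow> dtree \<Rightarrow> (nat \<Rightarrow> real) \<Rightarrow> point set" where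
  "Q_common d p t \<sigma> =
     {(x, y, z).
        (\<forall>i\<in>{1..d}. \<forall>j. 1 \<le> j \<and> j + 1 \<le> num_thresholds t i \<longrightarrow> x (i, j) \<le> x (i, j + 1)) \<and>
        (\<Sum>l=1..p. z l) = 1 \<and>
        y = (\<Sum>l=1..p. \<sigma> l * z l) \<and>
        x \<in> x_index d t \<rightarrow>\<^sub>E {0..1} \<and>
        z \<in> {1..p} \<rightarrow>\<^sub>E {0..}}"

definition Q_misic :: "nat \<Rightarrow> nat \<Rightarrow> dtree \<Rightarrow> (nat \<Rightarrow> real) \<Rightarrow> point set" where
  "Q_misic d p t \<sigma> =
     {(x, y, z) \<in> Q_common d p t \<sigma>.
        \<forall>s\<in>splits t.
          (\<Sum>l\<in>left s. z l) \<le> x (V s, C t s) \<and>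
          (\<Sum>l\<in>right s. z l) \<le> 1 - x (V s, C t s)}"

definition Q_expset :: "nat \<Rightarrow> nat \<Rightarrow> dtree \<Rightarrow> (nat \<Rightarrow> real) \<Rightarrow> point set" where
  "Q_expset d p t \<sigma> =
     {(x, y, z) \<in> Q_common d p t \<sigma>.
        \<forall>s\<in>splits t.
          (\<Sum>l\<in>below t s. z l) \<le> x (V s, C t s) \<and>
          (\<Sum>l\<in>above t s. z l) \<le> 1 - x (V s, C t s)}"

text \<open>\<open>{0, 1}\<^sup>K \<times> \<real>\<^sup>1\<^sup>+\<^sup>p\<close>\<close>

definition binary_x :: "nat \<Rightarrow> nat \<Rightarrow> dtree \<Rightarrow> point set" where
  "binary_x d p t = (x_index d t \<rightarrow>\<^sub>E {0, 1}) \<times> UNIV \<times> ({1..p} \<rightarrow>\<^sub>E UNIV)"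

end

theory Submission
  imports Defs
begin

text \<open>
  Every split \<open>s\<close> is one of the splits that contribute to \<open>below t s\<close> and \<open>above t s\<close>, so the
  inequalities of \<open>Q_expset\<close> have more nonnegative terms on the left than those of \<open>Q_misic\<close>
  and imply them; this is the inclusion.

  Conversely, let \<open>x\<close> be binary and satisfy the inequalities of \<open>Q_misic\<close>. If
  \<open>x (V s, C t s) = 1\<close>, the inequality for \<open>below t s\<close> only says that the total weight of some
  leaves is at most \<open>1\<close>. By monotonicity of \<open>x (i, j)\<close> in \<open>j\<close>, every split \<open>s'\<close> on the same
  feature with \<open>C t s' \<ge> C t s\<close> also has value \<open>1\<close>, so its own inequality forces \<open>z = 0\<close> on
  \<open>right s'\<close>; as \<open>above t s\<close> is the union of these leaf sets, it carries no weight at all. The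
  case \<open>x (V s, C t s) = 0\<close> is symmetric. Integrality of \<open>x\<close> matters because the bounds on the
  individual leaf sets do not add up to a bound on their union, except when they are all zero.

  What remains is that the rank \<open>C t s\<close> really is an index of a coordinate of \<open>x\<close>, for which
  \<open>theta t i\<close> has to enumerate the thresholds on feature \<open>i\<close> without repetition
  (lemma \<open>bij_betw_theta\<close>).
\<close>

section \<open>Splits and ranks of thresholds\<close>

lemma finite_splits: "finite (splits t)"
  by (induction t) auto

lemma leaves_branches_subset:
  assumes "s \<in> splits t"
  shows left_subset_leaves: "left s \<subseteq> set (leaves t)"
    and right_subset_leaves: "right s \<subseteq> set (leaves t)"
  using assms by (induction t) (auto simp: left_def right_def)

lemma finite_thresholds: "finite (thresholds t i)"
proof -
  have "thresholds t i = threshold ` {s \<in> splits t. feature s = i}"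
    by (auto simp: thresholds_def)
  then show ?thesis
    by (simp add: finite_splits)
qed

lemma bij_betw_theta: "bij_betw (theta t i) {1..num_thresholds t i} (thresholds t i)"
proof -
  let ?xs = "sorted_list_of_set (thresholds t i)"
  have "bij_betw ((!) ?xs) {..<num_thresholds t i} (thresholds t i)"
    by (rule bij_betw_nth) (simp_all add: num_thresholds_def finite_thresholds)
  moreover have "bij_betw (\<lambda>j. j - 1) {1..num_thresholds t i} {..<num_thresholds t i}"
    by (rule bij_betw_byWitness[where f' = Suc]) auto
  ultimately have "bij_betw ((!) ?xs \<circ> (\<lambda>j. j - 1)) {1..num_thresholds t i} (thresholds t i)"
    by (rule bij_betw_trans[rotated])
  then show ?thesis
    by (simp add: theta_def[abs_def] comp_def)
qed

text \<open>
  The definite description in \<open>C\<close> denotes: the threshold of a split of \<open>t\<close> is enumerated by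
  \<open>theta\<close>, and only once.
\<close>

lemma C_in_range:
  assumes "s \<in> splits t"
  shows "C t s \<in> {1..num_thresholds t (V s)}"
proof -
  have "threshold s \<in> thresholds t (V s)"
    using assms by (auto simp: thresholds_def V_def)
  then obtain j where j: "j \<in> {1..num_thresholds t (V s)}" "theta t (V s) j = threshold s"
    using bij_betw_imp_surj_on[OF bij_betw_theta[of t "V s"]] by (metis imageE)
  have "C t s = j"
    unfolding C_def
  proof (rule the_equality)
    show "k = j" if "k \<in> {1..num_thresholds t (V s)} \<and> theta t (V s) k = threshold s" for k
      using inj_onD[OF bij_betw_imp_inj_on[OF bij_betw_theta[of t "V s"]], of k j] that j by simp
  qed (use j in simp)
  with j show ?thesis by simp
qed

lemma split_index_in_x_index:
  assumes "decision_tree d p t" and "s \<in> splits t"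
  shows "(V s, C t s) \<in> x_index d t"
  using assms C_in_range[of s t] by (auto simp: x_index_def decision_tree_def V_def)

lemma left_subset_below: "s \<in> splits t \<Longrightarrow> left s \<subseteq> below t s"
  by (auto simp: below_def)

lemma right_subset_above: "s \<in> splits t \<Longrightarrow> right s \<subseteq> above t s"
  by (auto simp: above_def)

lemma below_subset_leaves: "below t s \<subseteq> set (leaves t)"
  using left_subset_leaves by (fastforce simp: below_def)

lemma above_subset_leaves: "above t s \<subseteq> set (leaves t)"
  using right_subset_leaves by (fastforce simp: above_def)

section \<open>Consequences of the common constraints\<close>

lemma Q_common_x_mono:
  assumes "(x, y, z) \<in> Q_common d p t \<sigma>" and "i \<in> {1..d}"
    and "1 \<le> j" and "j \<le> k" and "k \<le> num_thresholds t i"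
  shows "x (i, j) \<le> x (i, k)"
  using \<open>j \<le> k\<close> \<open>k \<le> num_thresholds t i\<close>
proof (induction k rule: dec_induct)
  case base
  show ?case by simp
next
  case (step k)
  have "x (i, k) \<le> x (i, k + 1)"
    using assms(1-3) step by (auto simp: Q_common_def)
  with step show ?case by simp
qed

lemma Q_common_z_nonneg:
  assumes "(x, y, z) \<in> Q_common d p t \<sigma>" and "l \<in> {1..p}"
  shows "0 \<le> z l"
  using assms by (auto simp: Q_common_def PiE_iff)

lemma Q_common_sum_mono:
  assumes "(x, y, z) \<in> Q_common d p t \<sigma>" and "A \<subseteq> B" and "B \<subseteq> {1..p}"
  shows "sum z A \<le> sum z B"
  using assms Q_common_z_nonneg[OF assms(1)]
  by (intro sum_mono2) (auto intro: finite_subset)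

lemma Q_common_sum_le_1:
  assumes "(x, y, z) \<in> Q_common d p t \<sigma>" and "A \<subseteq> {1..p}"
  shows "sum z A \<le> 1"
  using Q_common_sum_mono[OF assms order_refl] assms(1) by (auto simp: Q_common_def)

text \<open>
  Upper bounds on the weights of overlapping sets do not in general bound the weight of their
  union, but the bound zero does, since then every single term vanishes.
\<close>

lemma sum_UNION_nonpos:
  fixes z :: "'a \<Rightarrow> 'b :: ordered_comm_monoid_add"
  assumes "finite B" and nonneg: "\<And>l. l \<in> B \<Longrightarrow> 0 \<le> z l"
    and sub: "\<And>i. i \<in> I \<Longrightarrow> A i \<subseteq> B" and nonpos: "\<And>i. i \<in> I \<Longrightarrow> sum z (A i) \<le> 0"
  shows "sum z (\<Union>i\<in>I. A i) \<le> 0"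
proof -
  have "z l = 0" if "i \<in> I" "l \<in> A i" for i l
  proof -
    have "finite (A i)" and ge: "\<And>l. l \<in> A i \<Longrightarrow> 0 \<le> z l"
      using sub[OF \<open>i \<in> I\<close>] nonneg \<open>finite B\<close> by (auto intro: finite_subset)
    moreover have "sum z (A i) = 0"
      using nonpos[OF \<open>i \<in> I\<close>] sum_nonneg[of "A i" z, OF ge] by (simp add: antisym)
    ultimately show ?thesis
      using \<open>l \<in> A i\<close> by (simp add: sum_nonneg_eq_0_iff)
  qed
  then have "sum z (\<Union>i\<in>I. A i) = 0"
    by (intro sum.neutral) auto
  then show ?thesis by simp
qed

section \<open>Comparison of the two formulations\<close>

lemma Q_expset_subset_Q_misic:
  assumes t: "decision_tree d p t"
  shows "Q_expset d p t \<sigma> \<subseteq> Q_misic d p t \<sigma>"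
proof
  fix q assume q: "q \<in> Q_expset d p t \<sigma>"
  obtain x y z where [simp]: "q = (x, y, z)"
    by (cases q)
  have common: "(x, y, z) \<in> Q_common d p t \<sigma>"
    using q by (simp add: Q_expset_def)
  have leaves: "set (leaves t) = {1..p}"
    using t by (simp add: decision_tree_def)
  have "sum z (left s) \<le> x (V s, C t s) \<and> sum z (right s) \<le> 1 - x (V s, C t s)"
    if s: "s \<in> splits t" for s
  proof -
    have "sum z (left s) \<le> sum z (below t s)" "sum z (right s) \<le> sum z (above t s)"
      using Q_common_sum_mono[OF common] left_subset_below[OF s] right_subset_above[OF s]
        below_subset_leaves[of t s] above_subset_leaves[of t s] leaves by auto
    then show ?thesis
      using q s by (fastforce simp: Q_expset_def)
  qed
  with common show "q \<in> Q_misic d p t \<sigma>"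
    by (simp add: Q_misic_def)
qed

text \<open>
  A value of \<open>1\<close> spreads to all higher ranks and empties the right subtrees there; a value of
  \<open>0\<close> spreads to all lower ranks and empties the left subtrees there.
\<close>

lemma Q_misic_binary_subset_Q_expset:
  assumes t: "decision_tree d p t"
  shows "Q_misic d p t \<sigma> \<inter> binary_x d p t \<subseteq> Q_expset d p t \<sigma>"
proof
  fix q assume q: "q \<in> Q_misic d p t \<sigma> \<inter> binary_x d p t"
  obtain x y z where [simp]: "q = (x, y, z)"
    by (cases q)
  have common: "(x, y, z) \<in> Q_common d p t \<sigma>"
    using q by (simp add: Q_misic_def)
  have misic: "sum z (left s) \<le> x (V s, C t s)" "sum z (right s) \<le> 1 - x (V s, C t s)"
    if "s \<in> splits t" for s
    using q that by (auto simp: Q_misic_def)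
  have binary: "x (V s, C t s) = 0 \<or> x (V s, C t s) = 1" if "s \<in> splits t" for s
    using q split_index_in_x_index[OF t that] by (auto simp: binary_x_def PiE_iff)
  have leaves: "set (leaves t) = {1..p}"
    using t by (simp add: decision_tree_def)
  have x_mono: "x (V s, C t s) \<le> x (V s', C t s')"
    if "s \<in> splits t" "s' \<in> splits t" "V s' = V s" "C t s \<le> C t s'" for s s'
    using Q_common_x_mono[OF common, of "V s" "C t s" "C t s'"] that
      split_index_in_x_index[OF t that(1)] split_index_in_x_index[OF t that(2)]
    by (auto simp: x_index_def)
  have "sum z (below t s) \<le> x (V s, C t s) \<and> sum z (above t s) \<le> 1 - x (V s, C t s)"
    if s: "s \<in> splits t" for s
    using binary[OF s]
  proof
    assume x0: "x (V s, C t s) = 0"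
    have "sum z (left s') \<le> 0" if "s' \<in> splits t" "V s' = V s" "C t s' \<le> C t s" for s'
      using misic(1)[OF that(1)] x_mono[OF that(1) s] that x0 by simp
    then have "sum z (below t s) \<le> 0"
      unfolding below_def using left_subset_leaves[of _ t, unfolded leaves]
      by (intro sum_UNION_nonpos[of "{1..p}"] Q_common_z_nonneg[OF common]) auto
    moreover have "sum z (above t s) \<le> 1"
      using Q_common_sum_le_1[OF common] above_subset_leaves[of t s] leaves by simp
    ultimately show ?thesis
      using x0 by simp
  next
    assume x1: "x (V s, C t s) = 1"
    have "sum z (right s') \<le> 0" if "s' \<in> splits t" "V s' = V s" "C t s' \<ge> C t s" for s'
      using misic(2)[OF that(1)] x_mono[OF s that(1)] that x1 by simp
    then have "sum z (above t s) \<le> 0"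
      unfolding above_def using right_subset_leaves[of _ t, unfolded leaves]
      by (intro sum_UNION_nonpos[of "{1..p}"] Q_common_z_nonneg[OF common]) auto
    moreover have "sum z (below t s) \<le> 1"
      using Q_common_sum_le_1[OF common] below_subset_leaves[of t s] leaves by simp
    ultimately show ?thesis
      using x1 by simp
  qed
  with common show "q \<in> Q_expset d p t \<sigma>"
    by (simp add: Q_expset_def)
qed

theorem proposition2:
  fixes d p :: nat and t :: dtree and \<sigma> :: "nat \<Rightarrow> real"
  assumes "decision_tree d p t"
  shows "Q_expset d p t \<sigma> \<inter> binary_x d p t = Q_misic d p t \<sigma> \<inter> binary_x d p t
         \<and> Q_expset d p t \<sigma> \<subseteq> Q_misic d p t \<sigma>"
  using Q_expset_subset_Q_misic[OF assms] Q_misic_binary_subset_Q_expset[OF assms] by blast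

end
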